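(* Let $\mathbb{G}$ be a homogeneous group and $\Omega\subseteq\mathbb{G}$ an open set. Let $D:C^\infty(\Omega)\to\mathrm{Lip}(\Omega)$ be a linear map such that, for some function $h:\Omega\to[0,\infty)$, $$|D(f)(x)|\le h(x)\,|\nabla_Hf(x)|\qquad\text{for every }x\in\Omega\text{ and }f\in C^\infty(\Omega).$$ Then there exists a unique $b\in\mathrm{Lip}(H\Omega)$ such that $D$ is induced by $b$, i.e. $D=D_b$.
   Context: A homogeneous group is a graded finite-dimensional real linear space $\mathbb{G}=H^1\oplus\cdots\oplus H^\iota$ equipped with a Lie algebra structure satisfying $[H^i,H^j]\subseteq H^{i+j}$ (with $H^k=\{0\}$ for $k>\iota$), and with the group operation given by the Baker-Campbell-Hausdorff formula; its identity is $0$. Dilations $\delta_r$, $r>0$, are the linear maps with $\delta_r(x)=r^jx$ for $x\in H^j$. Fix a graded basis $(e_1,\dots,e_{\mathrm q})$ (a basis of $H^1$, followed by one of $H^2$, and so on), identifying $\mathbb{G}$ with $\mathbb{R}^{\mathrm q}$; let $\mathrm m=\dim H^1$ and let $X_i$ be the left-invariant vector field with $X_i(0)=e_i$. A homogeneous distance is a (continuous) left-invariant distance $d$ on $\mathbb{G}$ with $d(\delta_rx,\delta_ry)=r\,d(x,y)$; all such distances are bi-Lipschitz equivalent, and one is fixed. $\mathrm{Lip}(\Omega)$ is the space of real functions on $\Omega$ that are Lipschitz with respect to $d$. The horizontal gradient of $f$ is $\nabla_Hf=(X_1f,\dots,X_{\mathrm m}f)$ and $|\nabla_Hf|=\big(\sum_{i=1}^{\mathrm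 m}|X_if|^2\big)^{1/2}$. $\mathrm{Lip}(H\Omega)$ is the set of Lipschitz horizontal vector fields, i.e. $b(x)=\sum_{i=1}^{\mathrm m}a_i(x)X_i(x)$, $x\in\Omega$, with all $a_i\in\mathrm{Lip}(\Omega)$. Such $b$ induces the linear map $D_b(f)=\sum_{i=1}^{\mathrm m}a_iX_if$ on $C^\infty(\Omega)$. *)

theory Defs
  imports "HOL-Analysis.Analysis"
begin

text \<open>
  The linear space \<open>\<G>\<close> is a type \<open>'a\<close> of class \<^class>\<open>real_normed_vector\<close> that is assumed
  finite-dimensional below. The norm is auxiliary: all norms on a finite-dimensional space are
  equivalent, and it is used only for the topology and for Frechet derivatives.
  The class \<open>euclidean_space\<close> is avoided because it excludes dimension 0 and carries
  an inner product that has no relation to the grading.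
\<close>

text \<open>\<open>H j\<close> is the layer of degree \<open>j\<close> for \<open>j \<ge> 1\<close> (\<open>H 0\<close> plays no role), and \<open>s\<close> is the number
  of layers, written \<open>\<iota>\<close> in the usual notation.\<close>

definition layer_decomposition :: "(nat \<Rightarrow> 'a::real_vector set) \<Rightarrow> nat \<Rightarrow> 'a \<Rightarrow> (nat \<Rightarrow> 'a) \<Rightarrow> bool"
  where "layer_decomposition H s x u \<longleftrightarrow>
    (\<forall>j\<in>{1..s}. u j \<in> H j) \<and> (\<forall>j. j \<notin> {1..s} \<longrightarrow> u j = 0) \<and> x = (\<Sum>j=1..s. u j)"

definition lie_bracket :: "('a::real_vector \<Rightarrow> 'a \<Rightarrow> 'a) \<Rightarrow> bool"
  where "lie_bracket br \<longleftrightarrow>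
    (\<forall>x. linear (br x)) \<and> (\<forall>y. linear (\<lambda>x. br x y)) \<and> (\<forall>x. br x x = 0) \<and>
    (\<forall>x y z. br x (br y z) + br y (br z x) + br z (br x y) = 0)"

definition homogeneous_group ::
    "('a::real_normed_vector \<Rightarrow> 'a \<Rightarrow> 'a) \<Rightarrow> (nat \<Rightarrow> 'a set) \<Rightarrow> nat \<Rightarrow> bool"
  where "homogeneous_group br H s \<longleftrightarrow>
    (\<exists>B::'a set. finite B \<and> span B = UNIV) \<and>
    lie_bracket br \<and>
    (\<forall>j\<ge>1. subspace (H j)) \<and>
    (\<forall>j>s. H j = {0}) \<and>
    (\<forall>x. \<exists>!u. layer_decomposition H s x u) \<and>
    (\<forall>i\<ge>1. \<forall>j\<ge>1. \<forall>x\<in>H i. \<forall>y\<in>H j. br x y \<in> H (i + j))"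

text \<open>
  The Baker-Campbell-Hausdorff formula in Dynkin's form. An index
  \<open>[(r\<^sub>1, t\<^sub>1), \<dots>, (r\<^sub>n, t\<^sub>n)]\<close> stands for the right-nested bracket of the word
  \<open>x^r\<^sub>1 y^t\<^sub>1 \<dots> x^r\<^sub>n y^t\<^sub>n\<close>, with coefficient
  \<open>(-1)\<^sup>n\<^sup>-\<^sup>1 / (n \<cdot> (\<Sum>\<^sub>i (r\<^sub>i + t\<^sub>i)) \<cdot> \<Prod>\<^sub>i r\<^sub>i! t\<^sub>i!)\<close>.
  Brackets of words longer than the number of layers vanish, so the series is
  truncated to words of length at most \<open>s\<close>, which leaves finitely many indices.
\<close>

fun nested_bracket :: "('a::real_vector \<Rightarrow> 'a \<Rightarrow> 'a) \<Rightarrow> 'a list \<Rightarrow> 'a"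
  where
    "nested_bracket br [] = 0"
  | "nested_bracket br [x] = x"
  | "nested_bracket br (x # y # zs) = br x (nested_bracket br (y # zs))"

definition dynkin_degree :: "(nat \<times> nat) list \<Rightarrow> nat"
  where "dynkin_degree ps = (\<Sum>(r, t)\<leftarrow>ps. r + t)"

definition dynkin_indices :: "nat \<Rightarrow> (nat \<times> nat) list set"
  where "dynkin_indices s =
    {ps. ps \<noteq> [] \<and> (\<forall>(r, t)\<in>set ps. r + t \<ge> 1) \<and> dynkin_degree ps \<le> s}"

definition dynkin_coeff :: "(nat \<times> nat) list \<Rightarrow> real"
  where "dynkin_coeff ps = (-1) ^ (length ps - 1) /
    (real (length ps) * real (dynkin_degree ps) * (\<Prod>(r, t)\<leftarrow>ps. fact r * fact t))"

definition dynkin_word :: "'a \<Rightarrow> 'a \<Rightarrow> (nat \<times> nat) list \<Rightarrow> 'a list"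
  where "dynkin_word x y ps = concat (map (\<lambda>(r, t). replicate r x @ replicate t y) ps)"

definition bch :: "('a::real_vector \<Rightarrow> 'a \<Rightarrow> 'a) \<Rightarrow> nat \<Rightarrow> 'a \<Rightarrow> 'a \<Rightarrow> 'a"
  where "bch br s x y =
    (\<Sum>ps\<in>dynkin_indices s. dynkin_coeff ps *\<^sub>R nested_bracket br (dynkin_word x y ps))"

definition dilation :: "(nat \<Rightarrow> 'a::real_vector set) \<Rightarrow> nat \<Rightarrow> real \<Rightarrow> 'a \<Rightarrow> 'a"
  where "dilation H s r x = (\<Sum>j=1..s. r ^ j *\<^sub>R (THE u. layer_decomposition H s x u) j)"

definition homogeneous_distance ::
    "('a::real_normed_vector \<Rightarrow> 'a \<Rightarrow> 'a) \<Rightarrow> (nat \<Rightarrow> 'a set) \<Rightarrow> nat \<Rightarrow> ('a \<Rightarrow> 'a \<Rightarrow> real) \<Rightarrow> bool"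
  where "homogeneous_distance br H s d \<longleftrightarrow>
    Metric_space UNIV d \<and>
    continuous_on UNIV (\<lambda>(x, y). d x y) \<and>
    (\<forall>x y z. d (bch br s z x) (bch br s z y) = d x y) \<and>
    (\<forall>r>0. \<forall>x y. d (dilation H s r x) (dilation H s r y) = r * d x y)"

text \<open>A basis \<open>e 1, \<dots>, e q\<close> (indices start at 1) consisting of a basis of \<open>H 1\<close>, followed by one
  of \<open>H 2\<close>, and so on.\<close>

definition graded_basis :: "(nat \<Rightarrow> 'a::real_vector set) \<Rightarrow> nat \<Rightarrow> (nat \<Rightarrow> 'a) \<Rightarrow> bool"
  where "graded_basis H s e \<longleftrightarrow>
    (\<forall>j\<in>{1..s}. let I = {(\<Sum>i=1..<j. dim (H i)) <.. (\<Sum>i=1..j. dim (H i))} in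
       inj_on e I \<and> independent (e ` I) \<and> span (e ` I) = H j)"

text \<open>The left-invariant field with value \<open>e i\<close> at the identity: the value at \<open>x\<close> is the image of
  \<open>e i\<close> under the differential at \<open>0\<close> of the left translation by \<open>x\<close>.\<close>

definition left_inv_field ::
    "('a::real_normed_vector \<Rightarrow> 'a \<Rightarrow> 'a) \<Rightarrow> nat \<Rightarrow> (nat \<Rightarrow> 'a) \<Rightarrow> nat \<Rightarrow> 'a \<Rightarrow> 'a"
  where "left_inv_field br s e i x = frechet_derivative (bch br s x) (at 0) (e i)"

definition left_inv_deriv ::
    "('a::real_normed_vector \<Rightarrow> 'a \<Rightarrow> 'a) \<Rightarrow> nat \<Rightarrow> (nat \<Rightarrow> 'a) \<Rightarrow> nat \<Rightarrow> ('a \<Rightarrow> real) \<Rightarrow> 'a \<Rightarrow> real"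
  where "left_inv_deriv br s e i f x = frechet_derivative f (at x) (left_inv_field br s e i x)"

definition horizontal_grad_norm ::
    "('a::real_normed_vector \<Rightarrow> 'a \<Rightarrow> 'a) \<Rightarrow> (nat \<Rightarrow> 'a set) \<Rightarrow> nat \<Rightarrow> (nat \<Rightarrow> 'a) \<Rightarrow> ('a \<Rightarrow> real) \<Rightarrow> 'a \<Rightarrow> real"
  where "horizontal_grad_norm br H s e f x =
    sqrt (\<Sum>i=1..dim (H 1). \<bar>left_inv_deriv br s e i f x\<bar>\<^sup>2)"

text \<open>
  A function on \<open>\<Omega>\<close> is represented by the total function extending it by \<open>0\<close>. In this way the
  sets below are vector spaces under the pointwise operations, and equality of functions (or of
  vector fields) is equality on \<open>\<Omega>\<close>.
\<close>

fun C_k_on :: "nat \<Rightarrow> 'a::real_normed_vector set \<Rightarrow> ('a \<Rightarrow> real) \<Rightarrow> bool"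
  where
    "C_k_on 0 \<Omega> f \<longleftrightarrow> continuous_on \<Omega> f"
  | "C_k_on (Suc k) \<Omega> f \<longleftrightarrow>
      (\<forall>x\<in>\<Omega>. f differentiable at x) \<and> (\<forall>v. C_k_on k \<Omega> (\<lambda>x. frechet_derivative f (at x) v))"

definition C_infinity :: "'a::real_normed_vector set \<Rightarrow> ('a \<Rightarrow> real) set"
  where "C_infinity \<Omega> = {f. (\<forall>k. C_k_on k \<Omega> f) \<and> (\<forall>x. x \<notin> \<Omega> \<longrightarrow> f x = 0)}"

definition Lip :: "('a \<Rightarrow> 'a \<Rightarrow> real) \<Rightarrow> 'a set \<Rightarrow> ('a \<Rightarrow> real) set"
  where "Lip d \<Omega> =
    {f. Lipschitz_continuous_map (submetric (metric (UNIV, d)) \<Omega>) euclidean_metric f \<and>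
        (\<forall>x. x \<notin> \<Omega> \<longrightarrow> f x = 0)}"

definition linear_on_C_infinity ::
    "'a::real_normed_vector set \<Rightarrow> (('a \<Rightarrow> real) \<Rightarrow> 'a \<Rightarrow> real) \<Rightarrow> bool"
  where "linear_on_C_infinity \<Omega> D \<longleftrightarrow>
    (\<forall>f\<in>C_infinity \<Omega>. \<forall>g\<in>C_infinity \<Omega>. D (\<lambda>x. f x + g x) = (\<lambda>x. D f x + D g x)) \<and>
    (\<forall>f\<in>C_infinity \<Omega>. \<forall>c::real. D (\<lambda>x. c * f x) = (\<lambda>x. c * D f x))"

definition horizontal_field ::
    "('a::real_normed_vector \<Rightarrow> 'a \<Rightarrow> 'a) \<Rightarrow> (nat \<Rightarrow> 'a set) \<Rightarrow> nat \<Rightarrow> (nat \<Rightarrow> 'a) \<Rightarrow> (nat \<Rightarrow> 'a \<Rightarrow> real) \<Rightarrow> 'a \<Rightarrow> 'a"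
  where "horizontal_field br H s e a x = (\<Sum>i=1..dim (H 1). a i x *\<^sub>R left_inv_field br s e i x)"

definition Lip_horizontal ::
    "('a::real_normed_vector \<Rightarrow> 'a \<Rightarrow> 'a) \<Rightarrow> (nat \<Rightarrow> 'a set) \<Rightarrow> nat \<Rightarrow> (nat \<Rightarrow> 'a) \<Rightarrow> ('a \<Rightarrow> 'a \<Rightarrow> real) \<Rightarrow>
      'a set \<Rightarrow> ('a \<Rightarrow> 'a) set"
  where "Lip_horizontal br H s e d \<Omega> =
    {horizontal_field br H s e a | a. \<forall>i\<in>{1..dim (H 1)}. a i \<in> Lip d \<Omega>}"

text \<open>\<open>D = D\<^sub>b\<close> on smooth functions, where \<open>D\<^sub>b f = \<Sum>\<^sub>i a\<^sub>i X\<^sub>i f\<close> for the coefficients \<open>a\<close> of \<open>b\<close>.\<close>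

definition induced_by ::
    "('a::real_normed_vector \<Rightarrow> 'a \<Rightarrow> 'a) \<Rightarrow> (nat \<Rightarrow> 'a set) \<Rightarrow> nat \<Rightarrow> (nat \<Rightarrow> 'a) \<Rightarrow> ('a \<Rightarrow> 'a \<Rightarrow> real) \<Rightarrow>
      'a set \<Rightarrow> (('a \<Rightarrow> real) \<Rightarrow> 'a \<Rightarrow> real) \<Rightarrow> ('a \<Rightarrow> 'a) \<Rightarrow> bool"
  where "induced_by br H s e d \<Omega> D b \<longleftrightarrow>
    (\<exists>a. (\<forall>i\<in>{1..dim (H 1)}. a i \<in> Lip d \<Omega>) \<and> b = horizontal_field br H s e a \<and>
      (\<forall>f\<in>C_infinity \<Omega>. D f = (\<lambda>x. \<Sum>i=1..dim (H 1). a i x * left_inv_deriv br s e i f x)))"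

end

theory Submission
  imports Defs
begin

text \<open>
  Modulo the layers of degree at least two, the group law is addition. A coordinate \<open>\<ell>\<^sub>i\<close> of the
  first layer is therefore additive on the group, so that \<open>X\<^sub>j \<ell>\<^sub>i\<close> is constant, equal to \<open>1\<close> for
  \<open>i = j\<close> and to \<open>0\<close> otherwise. This forces the coefficients \<open>a\<^sub>i = D \<ell>\<^sub>i\<close>. Conversely, for smooth
  \<open>f\<close> and a point \<open>x\<close>, the function \<open>f - (\<Sum>\<^sub>i X\<^sub>i f(x) \<ell>\<^sub>i)\<close> has zero horizontal gradient at \<open>x\<close>,
  so \<open>D\<close> annihilates it at \<open>x\<close>.
\<close>

section \<open>Linear maps on finite-dimensional normed spaces\<close>

text \<open>Since the complement of \<open>S\<close> is open, some ball of radius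
  \<open>\<delta>\<close> around \<open>b\<close> misses \<open>S\<close>. For nonzero
  \<open>c\<close>, dividing by \<open>c\<close> reduces the estimate to the distance from
  \<open>b\<close> to a point of \<open>S\<close>. It bounds the coefficient of \<open>b\<close> by
  the norm of the whole vector.\<close>

lemma closed_subspace_dist_line:
  fixes S :: "'a::real_normed_vector set"
  assumes "closed S" "subspace S" "b \<notin> S"
  obtains \<delta> where "\<delta> > 0" "\<And>c v. v \<in> S \<Longrightarrow> \<bar>c\<bar> * \<delta> \<le> norm (c *\<^sub>R b + v)"
proof -
  have "open (- S)" "b \<in> - S"
    using assms by auto
  then obtain \<delta> where \<delta>: "\<delta> > 0" "ball b \<delta> \<subseteq> - S"
    by (meson open_contains_ball)
  have "\<bar>c\<bar> * \<delta> \<le> norm (c *\<^sub>R b + v)" if v: "v \<in> S" for c v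
  proof (cases "c = 0")
    case False
    have "- (inverse c *\<^sub>R v) \<in> S"
      using assms(2) v by (simp add: subspace_neg subspace_scale)
    then have "\<delta> \<le> dist b (- (inverse c *\<^sub>R v))"
      using \<delta>(2) by (meson ComplD in_mono mem_ball not_le)
    moreover have "c *\<^sub>R b + v = c *\<^sub>R (b - (- (inverse c *\<^sub>R v)))"
      using False by (simp add: scaleR_right_distrib)
    ultimately show ?thesis
      by (simp add: dist_norm mult_left_mono)
  qed auto
  with \<delta>(1) show thesis
    by (rule that)
qed

text \<open>Adding one vector \<open>b\<close> to a closed span keeps it closed: along a convergent
  sequence the coefficients of \<open>b\<close> are Cauchy by the distance estimate, and what is
  left after subtracting their multiples of \<open>b\<close> converges inside the smaller
  span.\<close>

lemma closed_span_finite: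
  fixes B :: "'a::real_normed_vector set"
  assumes "finite B"
  shows "closed (span B)"
  using assms
proof induction
  case (insert b B)
  show ?case
  proof (cases "b \<in> span B")
    case True
    then show ?thesis
      using insert.IH by (simp add: span_redundant)
  next
    case False
    obtain \<delta> where \<delta>: "\<delta> > 0" "\<And>c v. v \<in> span B \<Longrightarrow> \<bar>c\<bar> * \<delta> \<le> norm (c *\<^sub>R b + v)"
      using closed_subspace_dist_line[OF insert.IH subspace_span False] by blast
    show ?thesis
      unfolding closed_sequential_limits
    proof (intro allI impI, elim conjE)
      fix x l
      assume x: "\<forall>n. x n \<in> span (insert b B)" and l: "x \<longlonglongrightarrow> l"
      from x have "\<forall>n. \<exists>k. x n - k *\<^sub>R b \<in> span B"
        by (simp add: span_insert)
      then obtain c where c: "\<And>n. x n - c n *\<^sub>R b \<in> span B"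
        by metis
      \<comment> \<open>Split \<open>x m - x n\<close> into \<open>(c m - c n) *\<^sub>R b\<close>
        and a vector of \<open>span B\<close>.\<close>
      have le: "\<bar>c m - c n\<bar> * \<delta> \<le> norm (x m - x n)" for m n
        using \<delta>(2)[OF span_diff[OF c[of m] c[of n]], of "c m - c n"]
        by (simp add: algebra_simps)
      have "Cauchy c"
        unfolding Cauchy_def
      proof (intro allI impI)
        fix r :: real
        assume "r > 0"
        then have "r * \<delta> > 0"
          using \<delta>(1) by simp
        then obtain M where "\<forall>m\<ge>M. \<forall>n\<ge>M. dist (x m) (x n) < r * \<delta>"
          using LIMSEQ_imp_Cauchy[OF l] unfolding Cauchy_def by blast
        then have "\<forall>m\<ge>M. \<forall>n\<ge>M. \<bar>c m - c n\<bar> * \<delta> < r * \<delta>"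
          using le by (metis dist_norm le_less_trans)
        then show "\<exists>M. \<forall>m\<ge>M. \<forall>n\<ge>M. dist (c m) (c n) < r"
          using \<delta>(1) by (auto simp: dist_real_def)
      qed
      then obtain c0 where "c \<longlonglongrightarrow> c0"
        using Cauchy_convergent_iff convergent_def by blast
      then have "(\<lambda>n. x n - c n *\<^sub>R b) \<longlonglongrightarrow> l - c0 *\<^sub>R b"
        by (intro tendsto_intros l)
      then have "l - c0 *\<^sub>R b \<in> span B"
        by (rule closed_sequentially[OF insert.IH c])
      then show "l \<in> span (insert b B)"
        by (auto simp: span_insert)
    qed
  qed
qed simp

lemma closed_subspace_finite_dim:
  fixes S B :: "'a::real_normed_vector set"
  assumes "finite B" "span B = UNIV" "subspace S"
  shows "closed S"
proof -
  obtain C where C: "C \<subseteq> S" "independent C" "S \<subseteq> span C"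
    using basis_exists by metis
  then have "S = span C"
    using assms(3) by (metis span_subspace)
  moreover have "finite C"
    using independent_span_bound[OF assms(1) C(2)] assms(2) by auto
  ultimately show ?thesis
    by (simp add: closed_span_finite)
qed

text \<open>The kernel is a subspace, hence closed. If \<open>b\<close> is normalized by
  \<open>f b = 1\<close>, every \<open>v\<close> is \<open>f v *\<^sub>R b\<close> plus a kernel
  vector, so the distance from \<open>b\<close> to the kernel controls \<open>f v\<close> by the
  norm of \<open>v\<close>.\<close>

lemma bounded_linear_functional_finite_dim:
  fixes f :: "'a::real_normed_vector \<Rightarrow> real"
  assumes "finite B" "span B = (UNIV :: 'a set)" "linear f"
  shows "bounded_linear f"
proof (cases "\<exists>w. f w \<noteq> 0")
  case True
  then obtain w where w: "f w \<noteq> 0"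
    by blast
  define b where "b = inverse (f w) *\<^sub>R w"
  have b: "f b = 1"
    using w assms(3) by (simp add: b_def linear_scale)
  have S: "subspace {v. f v = 0}"
    using assms(3) by (rule linear_subspace_kernel)
  obtain \<delta> where \<delta>: "\<delta> > 0" "\<And>c v. v \<in> {v. f v = 0} \<Longrightarrow> \<bar>c\<bar> * \<delta> \<le> norm (c *\<^sub>R b + v)"
    using closed_subspace_dist_line[OF closed_subspace_finite_dim[OF assms(1,2) S] S, of b] b
    by auto
  have "norm (f v) \<le> norm v * inverse \<delta>" for v
    using \<delta>(2)[of "v - f v *\<^sub>R b" "f v"] \<delta>(1) b assms(3)
    by (simp add: linear_diff linear_scale field_simps)
  then show ?thesis
    using assms(3) by (auto simp: bounded_linear_def bounded_linear_axioms_def)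
qed (use bounded_linear_zero in \<open>simp add: fun_eq_iff[symmetric]\<close>)

text \<open>The spanning set \<open>B\<close> may be dependent, so a basis \<open>C\<close> is taken
  instead. Its coordinates are linear functionals and therefore bounded.\<close>

lemma finite_dim_coordinates:
  fixes B :: "'a::real_normed_vector set"
  assumes "finite B" "span B = UNIV"
  obtains C :: "'a set" and \<phi> where "finite C" "\<And>b. bounded_linear (\<phi> b)" "\<And>x. x = (\<Sum>b\<in>C. \<phi> b x *\<^sub>R b)"
proof -
  obtain C :: "'a set" where C: "independent C" "span C = UNIV"
    using basis_exists[of UNIV] by (metis top.extremum_uniqueI)
  have fin: "finite C"
    using independent_span_bound[OF assms(1) C(1)] assms(2) by auto
  have "linear (\<lambda>x. representation C x b)" for b
    using C by (intro linearI) (auto simp: representation_add representation_scale)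
  then have "bounded_linear (\<lambda>x. representation C x b)" for b
    using bounded_linear_functional_finite_dim[OF assms] by blast
  moreover have "x = (\<Sum>b\<in>C. representation C x b *\<^sub>R b)" for x
    using sum_representation_eq[OF C(1) _ fin order_refl, of x] C(2) by simp
  ultimately show thesis
    by (intro that[OF fin])
qed

lemma bounded_linear_finite_dim:
  fixes f :: "'a::real_normed_vector \<Rightarrow> 'b::real_normed_vector"
  assumes "finite B" "span B = (UNIV :: 'a set)" "linear f"
  shows "bounded_linear f"
proof -
  obtain C :: "'a set" and \<phi> where C: "finite C" "\<And>b. bounded_linear (\<phi> b)"
    "\<And>x. x = (\<Sum>b\<in>C. \<phi> b x *\<^sub>R b)"
    using finite_dim_coordinates[OF assms(1,2)] by metis
  have "f x = (\<Sum>b\<in>C. \<phi> b x *\<^sub>R f b)" for x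
  proof -
    have "f x = f (\<Sum>b\<in>C. \<phi> b x *\<^sub>R b)"
      using C(3)[of x] by simp
    then show ?thesis
      using assms(3) by (simp add: linear_sum linear_scale)
  qed
  then have "f = (\<lambda>x. \<Sum>b\<in>C. \<phi> b x *\<^sub>R f b)"
    by blast
  moreover have "bounded_linear (\<lambda>x. \<Sum>b\<in>C. \<phi> b x *\<^sub>R f b)"
    by (intro bounded_linear_sum bounded_linear_compose[OF bounded_linear_scaleR_left] C(2))
  ultimately show ?thesis
    by simp
qed

text \<open>Expanding the first argument in coordinates writes \<open>br\<close> as a finite sum of
  products of a bounded functional of the first argument with a bounded linear map of the second.
  The product rule then applies to each term.\<close>

lemma differentiable_bilinear_finite_dim:
  fixes br :: "'a::real_normed_vector \<Rightarrow> 'a \<Rightarrow> 'b::real_normed_vector"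
    and f g :: "'c::real_normed_vector \<Rightarrow> 'a"
  assumes "finite B" "span B = (UNIV :: 'a set)"
    and lin: "\<And>x. linear (br x)" "\<And>y. linear (\<lambda>x. br x y)"
    and "f differentiable at z" "g differentiable at z"
  shows "(\<lambda>y. br (f y) (g y)) differentiable at z"
proof -
  obtain C :: "'a set" and \<phi> where C: "finite C" "\<And>b. bounded_linear (\<phi> b)"
    "\<And>x. x = (\<Sum>b\<in>C. \<phi> b x *\<^sub>R b)"
    using finite_dim_coordinates[OF assms(1,2)] by metis
  have eq: "br x y = (\<Sum>b\<in>C. \<phi> b x *\<^sub>R br b y)" for x y
  proof -
    have "br x y = br (\<Sum>b\<in>C. \<phi> b x *\<^sub>R b) y"
      using C(3)[of x] by simp
    then show ?thesis
      by (simp add: linear_sum[OF lin(2)] linear_scale[OF lin(2)])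
  qed
  have comp: "(\<lambda>y. F (k y)) differentiable at z"
    if "bounded_linear F" "k differentiable at z"
    for F :: "'a \<Rightarrow> 'd::real_normed_vector" and k
    using that bounded_linear.has_derivative unfolding differentiable_def by blast
  have "(\<lambda>y. br (f y) (g y)) = (\<lambda>y. \<Sum>b\<in>C. \<phi> b (f y) *\<^sub>R br b (g y))"
    by (rule ext) (rule eq)
  moreover have "(\<lambda>y. \<Sum>b\<in>C. \<phi> b (f y) *\<^sub>R br b (g y)) differentiable at z"
    using differentiable_scaleR[OF comp[OF C(2) assms(5)]
        comp[OF bounded_linear_finite_dim[OF assms(1,2) lin(1)] assms(6)]]
    by (intro differentiable_sum[OF C(1)] ballI)
  ultimately show ?thesis
    by (simp only:)
qed

section \<open>The space of smooth functions\<close>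

text \<open>Because \<open>\<Omega>\<close> is open, the two functions agree near each of its points
  and so have the same derivative there. This lets smoothness pass to extensions by zero and to
  explicit formulas for derivatives.\<close>

lemma C_k_on_cong:
  assumes "open \<Omega>" "\<And>x. x \<in> \<Omega> \<Longrightarrow> f x = g x" "C_k_on k \<Omega> f"
  shows "C_k_on k \<Omega> g"
  using assms(2,3)
proof (induction k arbitrary: f g)
  case 0
  then show ?case
    by (simp cong: continuous_on_cong)
next
  case (Suc k)
  have diff: "f differentiable at x" if "x \<in> \<Omega>" for x
    using Suc.prems that by simp
  have g: "(g has_derivative frechet_derivative f (at x)) (at x)" if x: "x \<in> \<Omega>" for x
    using has_derivative_transform_within_open[OF
        frechet_derivative_works[THEN iffD1, OF diff[OF x]] assms(1) x] Suc.prems(1) by blast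
  then have "frechet_derivative f (at x) = frechet_derivative g (at x)" if "x \<in> \<Omega>" for x
    using that frechet_derivative_at by blast
  moreover have "\<And>v. C_k_on k \<Omega> (\<lambda>x. frechet_derivative f (at x) v)"
    using Suc.prems by simp
  ultimately have "C_k_on k \<Omega> (\<lambda>x. frechet_derivative g (at x) v)" for v
    using Suc.IH[of "\<lambda>x. frechet_derivative f (at x) v"] by simp
  then show ?case
    using g by (auto simp: differentiable_def)
qed

lemma C_k_on_const: "C_k_on k \<Omega> (\<lambda>x. c)"
  by (induction k arbitrary: c) auto

text \<open>The derivative of \<open>f\<close> at any point is \<open>f\<close> itself, so each
  directional derivative is already a constant function.\<close>

lemma C_k_on_bounded_linear:
  assumes "bounded_linear f"
  shows "C_k_on k \<Omega> f"
proof (cases k)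
  case 0
  then show ?thesis
    using assms by (simp add: linear_continuous_on)
next
  case (Suc k)
  have "(f has_derivative f) (at x)" for x
    using assms by (rule bounded_linear_imp_has_derivative)
  then have "f differentiable at x" "frechet_derivative f (at x) = f" for x
    using differentiableI frechet_derivative_at by metis+
  then show ?thesis
    using Suc by (simp add: C_k_on_const)
qed

lemma C_k_on_add:
  assumes "open \<Omega>" "C_k_on k \<Omega> f" "C_k_on k \<Omega> g"
  shows "C_k_on k \<Omega> (\<lambda>x. f x + g x)"
  using assms(2,3)
proof (induction k arbitrary: f g)
  case (Suc k)
  have der: "((\<lambda>x. f x + g x) has_derivative
      (\<lambda>v. frechet_derivative f (at x) v + frechet_derivative g (at x) v)) (at x)" if "x \<in> \<Omega>" for x
    using Suc.prems that by (intro has_derivative_add) (auto simp: frechet_derivative_works[symmetric])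
  have "C_k_on k \<Omega> (\<lambda>x. frechet_derivative f (at x) v + frechet_derivative g (at x) v)" for v
    using Suc.prems by (intro Suc.IH) auto
  then have "C_k_on k \<Omega> (\<lambda>x. frechet_derivative (\<lambda>x. f x + g x) (at x) v)" for v
    by (rule C_k_on_cong[OF assms(1), rotated]) (simp add: frechet_derivative_at[OF der, symmetric])
  then show ?case
    using differentiableI[OF der] by simp
qed (auto intro: continuous_on_add)

lemma C_k_on_cmult:
  assumes "open \<Omega>" "C_k_on k \<Omega> f"
  shows "C_k_on k \<Omega> (\<lambda>x. c * f x)"
  using assms(2)
proof (induction k arbitrary: f)
  case (Suc k)
  have der: "((\<lambda>x. c * f x) has_derivative (\<lambda>v. c * frechet_derivative f (at x) v)) (at x)"
    if "x \<in> \<Omega>" for x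
    using Suc.prems that
    by (intro has_derivative_mult_right) (auto simp: frechet_derivative_works[symmetric])
  have *: "C_k_on k \<Omega> (\<lambda>x. c * frechet_derivative f (at x) v)" for v
    using Suc.prems by (intro Suc.IH) auto
  have "C_k_on k \<Omega> (\<lambda>x. frechet_derivative (\<lambda>x. c * f x) (at x) v)" for v
    by (rule C_k_on_cong[OF assms(1) _ *[of v]]) (simp add: frechet_derivative_at[OF der, symmetric])
  then have "\<forall>v. C_k_on k \<Omega> (\<lambda>x. frechet_derivative (\<lambda>x. c * f x) (at x) v)" ..
  moreover have "\<forall>x\<in>\<Omega>. (\<lambda>x. c * f x) differentiable at x"
    using differentiableI[OF der] ..
  ultimately show ?case
    unfolding C_k_on.simps by blast
qed (auto intro: continuous_on_mult_left)

lemma C_infinity_add: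
  "open \<Omega> \<Longrightarrow> f \<in> C_infinity \<Omega> \<Longrightarrow> g \<in> C_infinity \<Omega> \<Longrightarrow> (\<lambda>x. f x + g x) \<in> C_infinity \<Omega>"
  by (simp add: C_infinity_def C_k_on_add)

lemma C_infinity_cmult:
  "open \<Omega> \<Longrightarrow> f \<in> C_infinity \<Omega> \<Longrightarrow> (\<lambda>x. c * f x) \<in> C_infinity \<Omega>"
  by (simp add: C_infinity_def C_k_on_cmult)

lemma C_infinity_zero: "(\<lambda>x. 0) \<in> C_infinity \<Omega>"
  by (simp add: C_infinity_def C_k_on_const)

lemma C_infinity_bounded_linear:
  assumes "open \<Omega>" "bounded_linear l"
  shows "(\<lambda>x. if x \<in> \<Omega> then l x else 0) \<in> C_infinity \<Omega>"
  using C_k_on_cong[OF assms(1) _ C_k_on_bounded_linear[OF assms(2)]]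
  by (simp add: C_infinity_def)

lemma C_infinity_differentiable:
  assumes "f \<in> C_infinity \<Omega>" "x \<in> \<Omega>"
  shows "f differentiable at x"
proof -
  have "C_k_on (Suc 0) \<Omega> f"
    using assms(1) unfolding C_infinity_def by blast
  then show ?thesis
    using assms(2) by simp
qed

lemma C_infinity_lincomb:
  assumes "open \<Omega>" "finite I" "\<And>i. i \<in> I \<Longrightarrow> F i \<in> C_infinity \<Omega>"
  shows "(\<lambda>x. \<Sum>i\<in>I. c i * F i x) \<in> C_infinity \<Omega>"
  using assms(2,3)
  by (induction I) (simp_all add: C_infinity_zero C_infinity_add C_infinity_cmult assms(1))

lemma linear_on_C_infinity_add:
  "linear_on_C_infinity \<Omega> D \<Longrightarrow> f \<in> C_infinity \<Omega> \<Longrightarrow> g \<in> C_infinity \<Omega> \<Longrightarrow>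
    D (\<lambda>x. f x + g x) = (\<lambda>x. D f x + D g x)"
  by (simp add: linear_on_C_infinity_def)

lemma linear_on_C_infinity_cmult:
  "linear_on_C_infinity \<Omega> D \<Longrightarrow> f \<in> C_infinity \<Omega> \<Longrightarrow> D (\<lambda>x. c * f x) = (\<lambda>x. c * D f x)"
  by (simp add: linear_on_C_infinity_def)

lemma linear_on_C_infinity_lincomb:
  assumes "linear_on_C_infinity \<Omega> D" "open \<Omega>" "finite I" "\<And>i. i \<in> I \<Longrightarrow> F i \<in> C_infinity \<Omega>"
  shows "D (\<lambda>x. \<Sum>i\<in>I. c i * F i x) = (\<lambda>x. \<Sum>i\<in>I. c i * D (F i) x)"
  using assms(3,4)
proof (induction I)
  case empty
  \<comment> \<open>The empty sum is the zero function; homogeneity with factor \<open>0\<close>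
    shows that \<open>D\<close> sends it to zero.\<close>
  have "\<forall>c. D (\<lambda>x. c * 0) = (\<lambda>x. c * D (\<lambda>x. 0) x)"
    using linear_on_C_infinity_cmult[OF assms(1) C_infinity_zero] by blast
  from this[rule_format, of 0] show ?case
    by simp
next
  case (insert i I)
  have *: "(\<lambda>x. c i * F i x) \<in> C_infinity \<Omega>" "(\<lambda>x. \<Sum>i\<in>I. c i * F i x) \<in> C_infinity \<Omega>"
    using insert by (auto intro: C_infinity_cmult C_infinity_lincomb assms(2))
  have "D (\<lambda>x. c i * F i x + (\<Sum>i\<in>I. c i * F i x))
      = (\<lambda>x. D (\<lambda>x. c i * F i x) x + D (\<lambda>x. \<Sum>i\<in>I. c i * F i x) x)"
    by (rule linear_on_C_infinity_add[OF assms(1) *])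
  moreover have "D (\<lambda>x. c i * F i x) = (\<lambda>x. c i * D (F i) x)"
    using insert.prems by (intro linear_on_C_infinity_cmult[OF assms(1)]) simp
  ultimately show ?case
    using insert by simp
qed

section \<open>The group law modulo the higher layers\<close>

lemma homogeneous_groupD:
  fixes br :: "'a::real_normed_vector \<Rightarrow> 'a \<Rightarrow> 'a"
  assumes "homogeneous_group br H s"
  shows "\<exists>B::'a set. finite B \<and> span B = UNIV" "lie_bracket br" "\<forall>j\<ge>1. subspace (H j)"
    "\<forall>j>s. H j = {0}" "\<forall>x. \<exists>!u. layer_decomposition H s x u"
    "\<forall>i\<ge>1. \<forall>j\<ge>1. \<forall>x\<in>H i. \<forall>y\<in>H j. br x y \<in> H (i + j)"
  using assms by (simp_all add: homogeneous_group_def)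

lemma homogeneous_group_bracket_linear:
  assumes "homogeneous_group br H s"
  shows "linear (br x)" "linear (\<lambda>x. br x y)"
proof -
  have "\<forall>x. linear (br x)" "\<forall>y. linear (\<lambda>x. br x y)"
    using homogeneous_groupD(2)[OF assms] unfolding lie_bracket_def by - (elim conjE, assumption)+
  then show "linear (br x)" "linear (\<lambda>x. br x y)"
    by simp_all
qed

lemma homogeneous_group_subspace:
  assumes "homogeneous_group br H s" "j \<ge> 1"
  shows "subspace (H j)"
  using homogeneous_groupD(3)[OF assms(1)] assms(2) by simp

lemma homogeneous_group_layer_trivial:
  assumes "homogeneous_group br H s" "j > s"
  shows "H j = {0}"
  using homogeneous_groupD(4)[OF assms(1)] assms(2) by simp

lemma homogeneous_group_bracket_layer:
  assumes "homogeneous_group br H s" "i \<ge> 1" "j \<ge> 1" "x \<in> H i" "y \<in> H j"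
  shows "br x y \<in> H (i + j)"
  using homogeneous_groupD(6)[OF assms(1)] assms(2-) by simp

lemma homogeneous_group_decomposition:
  assumes "homogeneous_group br H s"
  obtains u where "layer_decomposition H s x u"
  using homogeneous_groupD(5)[OF assms] by (metis (full_types))

lemma homogeneous_group_decomposition_unique:
  assumes "homogeneous_group br H s" "layer_decomposition H s x u"
  shows "(THE u. layer_decomposition H s x u) = u"
proof (rule the1_equality)
  show "\<exists>!u. layer_decomposition H s x u"
    using homogeneous_groupD(5)[OF assms(1)] ..
qed (rule assms(2))

lemma layer_decompositionD:
  assumes "layer_decomposition H s x u"
  shows "j \<in> {1..s} \<Longrightarrow> u j \<in> H j" "j \<notin> {1..s} \<Longrightarrow> u j = 0" "x = (\<Sum>j=1..s. u j)"
  using assms unfolding layer_decomposition_def by blast+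

lemma layer_decomposition_add:
  assumes G: "homogeneous_group br H s"
    and u: "layer_decomposition H s x u" and v: "layer_decomposition H s y v"
  shows "layer_decomposition H s (x + y) (\<lambda>j. u j + v j)"
  unfolding layer_decomposition_def
proof (intro conjI ballI allI impI)
  fix j
  assume j: "j \<in> {1..s}"
  then show "u j + v j \<in> H j"
    by (intro subspace_add homogeneous_group_subspace[OF G] layer_decompositionD(1)[OF u]
        layer_decompositionD(1)[OF v]) simp_all
next
  fix j
  assume "j \<notin> {1..s}"
  then show "u j + v j = 0"
    using layer_decompositionD(2)[OF u] layer_decompositionD(2)[OF v] by (metis add_0)
next
  show "x + y = (\<Sum>j=1..s. u j + v j)"
    unfolding sum.distrib
    by (rule arg_cong2[OF layer_decompositionD(3)[OF u] layer_decompositionD(3)[OF v]])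
qed

lemma layer_decomposition_scaleR:
  assumes G: "homogeneous_group br H s" and u: "layer_decomposition H s x u"
  shows "layer_decomposition H s (c *\<^sub>R x) (\<lambda>j. c *\<^sub>R u j)"
  unfolding layer_decomposition_def
proof (intro conjI ballI allI impI)
  fix j
  assume j: "j \<in> {1..s}"
  then show "c *\<^sub>R u j \<in> H j"
    by (intro subspace_scale homogeneous_group_subspace[OF G] layer_decompositionD(1)[OF u]) simp_all
next
  fix j
  assume "j \<notin> {1..s}"
  then show "c *\<^sub>R u j = 0"
    using layer_decompositionD(2)[OF u] by (metis scaleR_zero_right)
next
  show "c *\<^sub>R x = (\<Sum>j=1..s. c *\<^sub>R u j)"
    unfolding scaleR_sum_right[symmetric] by (rule arg_cong[OF layer_decompositionD(3)[OF u]])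
qed

lemma layer_decomposition_single:
  assumes G: "homogeneous_group br H s" and j: "j \<ge> 1" and y: "y \<in> H j"
  shows "layer_decomposition H s y (\<lambda>i. if i = j then y else 0)"
proof -
  \<comment> \<open>Degrees above \<open>s\<close> are allowed: their layers are trivial, so the
    decomposition still vanishes outside \<open>{1..s}\<close>.\<close>
  have "y = 0" if "j > s"
    using homogeneous_group_layer_trivial[OF G that] y by simp
  then have "(if i = j then y else 0) = 0" if "i \<notin> {1..s}" for i
    using j that by auto
  moreover have "(if i = j then y else 0) \<in> H i" if "i \<in> {1..s}" for i
    using y that by (simp add: subspace_0 homogeneous_group_subspace[OF G])
  moreover have "y = (\<Sum>i=1..s. if i = j then y else 0)"
    using j \<open>j > s \<Longrightarrow> y = 0\<close> by (cases "j \<le> s") simp_all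
  ultimately show ?thesis
    unfolding layer_decomposition_def by blast
qed

section \<open>Linear coordinates of the first layer\<close>

lemma first_layer_trivial:
  assumes "homogeneous_group br H s" "\<not> s \<ge> 1"
  shows "dim (H 1) = 0"
proof -
  have "H 1 = {0}"
    using assms by (intro homogeneous_group_layer_trivial[OF assms(1)]) simp
  then show ?thesis
    by (intro dim_unique[of "{}"]) (simp_all add: independent_empty)
qed

text \<open>Project to the component in \<open>H 1\<close> along the other layers and take
  coordinates with respect to the first \<open>dim (H 1)\<close> basis vectors. The projection is
  linear because layer decompositions are unique and can be added and scaled.\<close>

lemma first_layer_coordinates:
  assumes G: "homogeneous_group br H s" and e: "graded_basis H s e"
  obtains l :: "nat \<Rightarrow> 'a::real_normed_vector \<Rightarrow> real" where
    "\<And>i. linear (l i)"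
    "\<And>i j. i \<in> {1..dim (H 1)} \<Longrightarrow> j \<in> {1..dim (H 1)} \<Longrightarrow> l i (e j) = (if i = j then 1 else 0)"
    "\<And>i j y. j \<ge> 2 \<Longrightarrow> y \<in> H j \<Longrightarrow> l i y = 0"
proof (cases "s \<ge> 1")
  case False
  then have "dim (H 1) = 0"
    by (rule first_layer_trivial[OF G])
  \<comment> \<open>With no layers, \<open>graded_basis\<close> gives no information on
    \<open>e\<close>, but there are no indices to check and zero functionals suffice.\<close>
  then show thesis
    by (intro that[of "\<lambda>_ _. 0"]) (auto intro: linearI)
next
  case True
  define E where "E = e ` {1..dim (H 1)}"
  have I: "{0<..n} = {Suc 0..n}" for n :: nat
    by auto
  \<comment> \<open>For \<open>j = 1\<close> the lower end of the index interval in
    \<open>graded_basis\<close> is an empty sum, so the interval starts right after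
    \<open>0\<close>.\<close>
  have inj: "inj_on e {1..dim (H 1)}" and E: "independent E" "span E = H 1"
    using bspec[OF e[unfolded graded_basis_def Let_def], of 1] True by (simp_all add: E_def I)
  define p where "p x = (THE u. layer_decomposition H s x u) 1" for x
  have pI: "p x = u 1" if "layer_decomposition H s x u" for x u
    using homogeneous_group_decomposition_unique[OF G that] by (simp add: p_def)
  have p_mem: "p x \<in> span E" for x
  proof -
    obtain u where u: "layer_decomposition H s x u"
      by (rule homogeneous_group_decomposition[OF G])
    then show ?thesis
      using pI[OF u] True E(2) by (simp add: layer_decomposition_def)
  qed
  have p_add: "p (x + y) = p x + p y" for x y
  proof -
    obtain u v where uv: "layer_decomposition H s x u" "layer_decomposition H s y v"
      by (meson homogeneous_group_decomposition[OF G])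
    show ?thesis
      using pI[OF layer_decomposition_add[OF G uv]] pI[OF uv(1)] pI[OF uv(2)] by simp
  qed
  have p_scale: "p (c *\<^sub>R x) = c *\<^sub>R p x" for c x
  proof -
    obtain u where u: "layer_decomposition H s x u"
      by (rule homogeneous_group_decomposition[OF G])
    show ?thesis
      using pI[OF layer_decomposition_scaleR[OF G u]] pI[OF u] by simp
  qed
  have p_single: "p y = (if j = 1 then y else 0)" if "j \<ge> 1" "y \<in> H j" for j y
    using pI[OF layer_decomposition_single[OF G that]] by simp
  show thesis
  proof (rule that[of "\<lambda>i x. representation E (p x) (e i)"])
    show "linear (\<lambda>x. representation E (p x) (e i))" for i
      using E p_mem
      by (intro linearI) (simp_all add: p_add p_scale representation_add representation_scale)
    show "representation E (p (e j)) (e i) = (if i = j then 1 else 0)"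
      if "i \<in> {1..dim (H 1)}" "j \<in> {1..dim (H 1)}" for i j
    proof -
      have "e j \<in> E"
        using that by (simp add: E_def)
      moreover from this have "p (e j) = e j"
        using p_single[of 1 "e j"] E(2) span_base by fastforce
      ultimately show ?thesis
        using that inj E(1) by (auto simp: representation_basis inj_on_eq_iff)
    qed
    show "representation E (p y) (e i) = 0" if "j \<ge> 2" "y \<in> H j" for i j y
      using p_single[of j y] that by (simp add: representation_zero)
  qed
qed

text \<open>Decompose both arguments into layers. By bilinearity only brackets of layers
  \<open>i\<close> and \<open>j\<close> with \<open>i, j \<ge> 1\<close> occur; they lie in
  \<open>H (i + j)\<close> with \<open>i + j \<ge> 2\<close>, where \<open>l\<close>
  vanishes.\<close>

lemma functional_bracket_eq_0:
  fixes l :: "'a::real_normed_vector \<Rightarrow> real"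
  assumes G: "homogeneous_group br H s" and l: "linear l"
    and l0: "\<And>j y. j \<ge> 2 \<Longrightarrow> y \<in> H j \<Longrightarrow> l y = 0"
  shows "l (br x y) = 0"
proof -
  note lin = homogeneous_group_bracket_linear[OF G]
  obtain u where u: "layer_decomposition H s x u"
    by (rule homogeneous_group_decomposition[OF G])
  obtain v where v: "layer_decomposition H s y v"
    by (rule homogeneous_group_decomposition[OF G])
  have "x = (\<Sum>i=1..s. u i)" "y = (\<Sum>j=1..s. v j)"
    using u v unfolding layer_decomposition_def by blast+
  then have "br x y = br (\<Sum>i=1..s. u i) (\<Sum>j=1..s. v j)"
    by (rule arg_cong2)
  then have "l (br x y) = (\<Sum>j=1..s. \<Sum>i=1..s. l (br (u i) (v j)))"
    by (simp add: linear_sum[OF lin(1)] linear_sum[OF lin(2)] linear_sum[OF l])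
  also have "\<dots> = 0"
  proof (intro sum.neutral ballI)
    fix i j
    assume ij: "i \<in> {1..s}" "j \<in> {1..s}"
    then have "u i \<in> H i" "v j \<in> H j"
      using u v unfolding layer_decomposition_def by blast+
    then have "br (u i) (v j) \<in> H (i + j)"
      using ij by (intro homogeneous_group_bracket_layer[OF G]) simp_all
    then show "l (br (u i) (v j)) = 0"
      using ij by (intro l0[of "i + j"]) simp_all
  qed
  finally show ?thesis .
qed

section \<open>The Dynkin series seen by first-layer functionals\<close>

lemma length_dynkin_word: "length (dynkin_word x y ps) = dynkin_degree ps"
  by (induction ps) (auto simp: dynkin_word_def dynkin_degree_def)

lemma length_le_dynkin_degree:
  assumes "\<forall>(r, t)\<in>set ps. r + t \<ge> 1"
  shows "length ps \<le> dynkin_degree ps"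
  using assms by (induction ps) (auto simp: dynkin_degree_def)

lemma le_dynkin_degree:
  assumes "(r, t) \<in> set ps"
  shows "r + t \<le> dynkin_degree ps"
  using assms by (induction ps) (auto simp: dynkin_degree_def)

text \<open>Every pair contributes at least one to the degree, so a bound on the degree bounds the
  number of pairs as well as their entries.\<close>

lemma finite_dynkin_indices: "finite (dynkin_indices s)"
proof (rule finite_subset)
  show "dynkin_indices s \<subseteq> {ps. set ps \<subseteq> {0..s} \<times> {0..s} \<and> length ps \<le> s}"
  proof (intro subsetI CollectI conjI)
    fix ps
    assume ps: "ps \<in> dynkin_indices s"
    then have deg: "dynkin_degree ps \<le> s"
      by (simp add: dynkin_indices_def)
    have "length ps \<le> dynkin_degree ps"
      using ps by (intro length_le_dynkin_degree) (simp add: dynkin_indices_def)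
    then show "length ps \<le> s"
      using deg by (rule order_trans)
    fix p
    assume "p \<in> set ps"
    then show "p \<in> {0..s} \<times> {0..s}"
      using le_dynkin_degree[of "fst p" "snd p" ps] deg by (simp add: mem_Times_iff)
  qed
qed (intro finite_lists_length_le finite_cartesian_product finite_atLeastAtMost)

lemma dynkin_degree_le_1:
  assumes "ps \<in> dynkin_indices s" "dynkin_degree ps \<le> 1"
  shows "ps = [(1, 0)] \<or> ps = [(0, 1)]"
proof -
  have "length ps \<le> 1" "ps \<noteq> []"
    using assms length_le_dynkin_degree[of ps] by (auto simp: dynkin_indices_def)
  then obtain r t where "ps = [(r, t)]"
    by (cases ps) auto
  then show ?thesis
    using assms by (auto simp: dynkin_indices_def dynkin_degree_def)
qed

text \<open>A word with at least two letters yields a bracket, which \<open>l\<close> annihilates.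
  Only the one-letter words \<open>x\<close> and \<open>y\<close> survive, each with coefficient
  one.\<close>

lemma functional_bch:
  fixes l :: "'a::real_normed_vector \<Rightarrow> real"
  assumes G: "homogeneous_group br H s" and l: "linear l"
    and l0: "\<And>j y. j \<ge> 2 \<Longrightarrow> y \<in> H j \<Longrightarrow> l y = 0"
    and s: "s \<ge> 1"
  shows "l (bch br s x y) = l x + l y"
proof -
  let ?t = "\<lambda>ps. dynkin_coeff ps * l (nested_bracket br (dynkin_word x y ps))"
  have "l (bch br s x y) = sum ?t (dynkin_indices s)"
    by (simp add: bch_def linear_sum[OF l] linear_scale[OF l])
  also have "\<dots> = sum ?t {[(1, 0)], [(0, 1)]}"
  proof (rule sum.mono_neutral_right[OF finite_dynkin_indices])
    \<comment> \<open>Here \<open>s \<ge> 1\<close> keeps the two one-letter words within the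
      truncation.\<close>
    show "{[(1, 0)], [(0, 1)]} \<subseteq> dynkin_indices s"
      using s by (auto simp: dynkin_indices_def dynkin_degree_def)
    show "\<forall>ps\<in>dynkin_indices s - {[(1, 0)], [(0, 1)]}. ?t ps = 0"
    proof
      fix ps
      assume "ps \<in> dynkin_indices s - {[(1, 0)], [(0, 1)]}"
      then have "length (dynkin_word x y ps) \<ge> 2"
        using dynkin_degree_le_1[of ps s] by (force simp: length_dynkin_word)
      then obtain a b zs where "dynkin_word x y ps = a # b # zs"
        by (metis Suc_le_length_iff numeral_2_eq_2)
      then show "?t ps = 0"
        using functional_bracket_eq_0[OF G l l0] by simp
    qed
  qed
  also have "\<dots> = l x + l y"
    by (simp add: dynkin_coeff_def dynkin_degree_def dynkin_word_def)
  finally show ?thesis .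
qed

section \<open>Differentiability of left translations and the left-invariant fields\<close>

lemma differentiable_nested_bracket:
  fixes br :: "'a::real_normed_vector \<Rightarrow> 'a \<Rightarrow> 'a" and fs :: "('b::real_normed_vector \<Rightarrow> 'a) list"
  assumes G: "homogeneous_group br H s" and "\<forall>f\<in>set fs. f differentiable at z"
  shows "(\<lambda>y. nested_bracket br (map (\<lambda>f. f y) fs)) differentiable at z"
  using assms(2)
proof (induction fs)
  case (Cons f fs)
  obtain B :: "'a set" where B: "finite B" "span B = UNIV"
    using homogeneous_groupD(1)[OF G] by blast
  note lin = homogeneous_group_bracket_linear[OF G]
  show ?case
  proof (cases fs)
    case Nil
    then show ?thesis
      using Cons.prems by simp
  next
    case (Cons g gs)
    then show ?thesis
      using differentiable_bilinear_finite_dim[OF B lin, of f z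
          "\<lambda>y. nested_bracket br (map (\<lambda>f. f y) fs)"] Cons.IH Cons.prems
      by simp
  qed
qed simp

lemma differentiable_bch:
  assumes G: "homogeneous_group br H s"
  shows "bch br s x differentiable at z"
proof -
  \<comment> \<open>The word in \<open>x\<close> and \<open>y\<close> is a word of functions, the
    letters being the constant \<open>x\<close> and the identity, evaluated at \<open>y\<close>.
    This exhibits each Dynkin term as a nested bracket of differentiable functions.\<close>
  have word: "dynkin_word x y ps = map (\<lambda>f. f y) (dynkin_word (\<lambda>_. x) (\<lambda>y. y) ps)" for y ps
    by (auto simp: dynkin_word_def map_concat intro!: arg_cong[of _ _ concat])
  have "\<forall>f\<in>set (dynkin_word (\<lambda>_. x) (\<lambda>y. y) ps). f differentiable at z" for ps
    by (auto simp: dynkin_word_def)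
  then have "(\<lambda>y. nested_bracket br (dynkin_word x y ps)) differentiable at z" for ps
    unfolding word by (rule differentiable_nested_bracket[OF G])
  then show ?thesis
    unfolding bch_def[abs_def]
    by (intro differentiable_sum ballI finite_dynkin_indices differentiable_scaleR) auto
qed

text \<open>Compute the derivative at \<open>0\<close> of \<open>l\<close> composed with left
  translation by \<open>x\<close> in two ways: the chain rule gives \<open>l\<close> of the
  differential of the translation, while additivity of \<open>l\<close> on the group gives
  \<open>l\<close>.\<close>

lemma functional_left_inv_field:
  fixes l :: "'a::real_normed_vector \<Rightarrow> real"
  assumes G: "homogeneous_group br H s" and l: "bounded_linear l"
    and l0: "\<And>j y. j \<ge> 2 \<Longrightarrow> y \<in> H j \<Longrightarrow> l y = 0"
    and s: "s \<ge> 1"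
  shows "l (left_inv_field br s e i x) = l (e i)"
proof -
  have "((\<lambda>y. l (bch br s x y)) has_derivative (\<lambda>v. l (frechet_derivative (bch br s x) (at 0) v))) (at 0)"
    using differentiable_bch[OF G]
    by (intro bounded_linear.has_derivative[OF l]) (simp add: frechet_derivative_works[symmetric])
  moreover have "((\<lambda>y. l (bch br s x y)) has_derivative l) (at 0)"
  proof -
    have "(\<lambda>y. l (bch br s x y)) = (\<lambda>y. l x + l y)"
      using l0 s by (intro ext functional_bch[OF G bounded_linear.linear[OF l]])
    moreover have "((\<lambda>y. l x + l y) has_derivative (\<lambda>v. 0 + l v)) (at 0)"
      by (intro has_derivative_add has_derivative_const bounded_linear_imp_has_derivative l)
    ultimately show ?thesis
      by simp
  qed
  ultimately have "(\<lambda>v. l (frechet_derivative (bch br s x) (at 0) v)) = l"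
    by (rule has_derivative_unique)
  from fun_cong[OF this] show ?thesis
    unfolding left_inv_field_def .
qed

lemma left_inv_deriv_bounded_linear:
  assumes "open \<Omega>" "x \<in> \<Omega>" "bounded_linear l"
  shows "left_inv_deriv br s e i (\<lambda>x. if x \<in> \<Omega> then l x else 0) x = l (left_inv_field br s e i x)"
proof -
  have "((\<lambda>x. if x \<in> \<Omega> then l x else 0) has_derivative l) (at x)"
    using has_derivative_transform_within_open[OF
        bounded_linear_imp_has_derivative[OF assms(3)] assms(1,2)] by simp
  then show ?thesis
    by (simp add: left_inv_deriv_def frechet_derivative_at[symmetric])
qed

lemma left_inv_deriv_add_lincomb:
  assumes "f differentiable at x" "\<And>j. j \<in> J \<Longrightarrow> F j differentiable at x"
  shows "left_inv_deriv br s e i (\<lambda>y. f y + (\<Sum>j\<in>J. c j * F j y)) x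
    = left_inv_deriv br s e i f x + (\<Sum>j\<in>J. c j * left_inv_deriv br s e i (F j) x)"
proof -
  have "((\<lambda>y. f y + (\<Sum>j\<in>J. c j * F j y)) has_derivative
      (\<lambda>v. frechet_derivative f (at x) v + (\<Sum>j\<in>J. c j * frechet_derivative (F j) (at x) v))) (at x)"
    using assms
    by (intro has_derivative_add has_derivative_sum has_derivative_mult_right)
      (auto simp: frechet_derivative_works[symmetric])
  then show ?thesis
    by (simp add: left_inv_deriv_def frechet_derivative_at[symmetric])
qed

section \<open>Existence and uniqueness of the inducing field\<close>

theorem lemma3p5:
  fixes br :: "'a::real_normed_vector \<Rightarrow> 'a \<Rightarrow> 'a"
    and H :: "nat \<Rightarrow> 'a set"
    and s :: nat
    and e :: "nat \<Rightarrow> 'a"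
    and d :: "'a \<Rightarrow> 'a \<Rightarrow> real"
    and \<Omega> :: "'a set"
    and D :: "('a \<Rightarrow> real) \<Rightarrow> ('a \<Rightarrow> real)"
    and h :: "'a \<Rightarrow> real"
  assumes "homogeneous_group br H s"
    and "graded_basis H s e"
    and "homogeneous_distance br H s d"
    and "open \<Omega>"
    and "D \<in> C_infinity \<Omega> \<rightarrow> Lip d \<Omega>"
    and "linear_on_C_infinity \<Omega> D"
    and "\<forall>x\<in>\<Omega>. h x \<ge> 0"
    and "\<forall>x\<in>\<Omega>. \<forall>f\<in>C_infinity \<Omega>. \<bar>D f x\<bar> \<le> h x * horizontal_grad_norm br H s e f x"
  shows "\<exists>!b. b \<in> Lip_horizontal br H s e d \<Omega> \<and> induced_by br H s e d \<Omega> D b"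
proof -
  note G = assms(1) and op = assms(4)
  let ?I = "{1..dim (H 1)}"
  let ?X = "left_inv_deriv br s e"
  obtain l :: "nat \<Rightarrow> 'a \<Rightarrow> real" where l: "\<And>i. linear (l i)"
    "\<And>i j. i \<in> ?I \<Longrightarrow> j \<in> ?I \<Longrightarrow> l i (e j) = (if i = j then 1 else 0)"
    "\<And>i j y. j \<ge> 2 \<Longrightarrow> y \<in> H j \<Longrightarrow> l i y = 0"
    using first_layer_coordinates[OF G assms(2)] by metis
  obtain B :: "'a set" where B: "finite B" "span B = UNIV"
    using homogeneous_groupD(1)[OF G] by blast
  have bl: "bounded_linear (l i)" for i
    using bounded_linear_functional_finite_dim[OF B l(1)] .
  \<comment> \<open>An index in \<open>?I\<close> makes \<open>dim (H 1)\<close> nonzero, which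
    excludes \<open>s = 0\<close>.\<close>
  have s: "s \<ge> 1" if "i \<in> ?I" for i
    using first_layer_trivial[OF G] that by fastforce
  \<comment> \<open>The coordinates serve as test functions; they are cut off to zero because
    members of \<open>C_infinity \<Omega>\<close> vanish outside \<open>\<Omega>\<close>.\<close>
  define F where "F i = (\<lambda>x. if x \<in> \<Omega> then l i x else 0)" for i
  have F: "F i \<in> C_infinity \<Omega>" for i
    unfolding F_def by (rule C_infinity_bounded_linear[OF op bl])
  have XF: "?X j (F i) x = (if i = j then 1 else 0)" if "i \<in> ?I" "j \<in> ?I" "x \<in> \<Omega>" for i j x
    unfolding F_def left_inv_deriv_bounded_linear[OF op that(3) bl]
    using functional_left_inv_field[OF G bl l(3) s[OF that(1)]] l(2) that by simp
  have Lip_F: "D (F i) \<in> Lip d \<Omega>" for i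
    using assms(5) F by blast
  have D_eq: "D f = (\<lambda>x. \<Sum>i\<in>?I. D (F i) x * ?X i f x)" if f: "f \<in> C_infinity \<Omega>" for f
  proof
    fix x
    show "D f x = (\<Sum>i\<in>?I. D (F i) x * ?X i f x)"
    proof (cases "x \<in> \<Omega>")
      case False
      \<comment> \<open>Outside \<open>\<Omega>\<close> both sides are zero, as all functions in
        \<open>Lip d \<Omega>\<close> vanish there.\<close>
      moreover have "D f \<in> Lip d \<Omega>"
        using assms(5) f by blast
      ultimately show ?thesis
        using Lip_F by (simp add: Lip_def)
    next
      case x: True
      \<comment> \<open>The coefficients are frozen at the point \<open>x\<close>, so the correction
        to \<open>f\<close> is a combination with real constants and linearity of \<open>D\<close>
        applies to it.\<close>
      let ?c = "\<lambda>i. - ?X i f x"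
      define g where "g = (\<lambda>y. f y + (\<Sum>i\<in>?I. ?c i * F i y))"
      have sum: "(\<lambda>y. \<Sum>i\<in>?I. ?c i * F i y) \<in> C_infinity \<Omega>"
        by (rule C_infinity_lincomb[OF op _ F]) simp
      have g: "g \<in> C_infinity \<Omega>"
        unfolding g_def by (rule C_infinity_add[OF op f sum])
      have "?X j g x = 0" if j: "j \<in> ?I" for j
      proof -
        have "?X j g x = ?X j f x + (\<Sum>i\<in>?I. ?c i * ?X j (F i) x)"
          unfolding g_def
          by (intro left_inv_deriv_add_lincomb C_infinity_differentiable[OF _ x] f F)
        also have "(\<Sum>i\<in>?I. ?c i * ?X j (F i) x) = (\<Sum>i\<in>?I. if i = j then ?c i else 0)"
          using XF[OF _ j x] by (intro sum.cong) auto
        also have "\<dots> = ?c j"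
          using j by simp
        finally show ?thesis
          by simp
      qed
      then have "horizontal_grad_norm br H s e g x = 0"
        by (simp add: horizontal_grad_norm_def)
      \<comment> \<open>The bound by \<open>h x\<close> times the horizontal gradient norm is used
        only here, at a point where that norm is zero.\<close>
      then have "D g x = 0"
        using assms(8) x g by force
      moreover have "D g = (\<lambda>y. D f y + D (\<lambda>y. \<Sum>i\<in>?I. ?c i * F i y) y)"
        unfolding g_def by (rule linear_on_C_infinity_add[OF assms(6) f sum])
      moreover have "D (\<lambda>y. \<Sum>i\<in>?I. ?c i * F i y) = (\<lambda>y. \<Sum>i\<in>?I. ?c i * D (F i) y)"
        by (rule linear_on_C_infinity_lincomb[OF assms(6) op _ F]) simp
      ultimately have "D f x = (\<Sum>i\<in>?I. ?X i f x * D (F i) x)"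
        by (simp add: sum_negf)
      then show ?thesis
        by (simp add: mult.commute)
    qed
  qed
  show ?thesis
  proof (rule ex1I[of _ "horizontal_field br H s e (\<lambda>i. D (F i))"])
    show "horizontal_field br H s e (\<lambda>i. D (F i)) \<in> Lip_horizontal br H s e d \<Omega> \<and>
        induced_by br H s e d \<Omega> D (horizontal_field br H s e (\<lambda>i. D (F i)))"
    proof
      show "horizontal_field br H s e (\<lambda>i. D (F i)) \<in> Lip_horizontal br H s e d \<Omega>"
        unfolding Lip_horizontal_def using Lip_F by blast
      show "induced_by br H s e d \<Omega> D (horizontal_field br H s e (\<lambda>i. D (F i)))"
        unfolding induced_by_def
        using D_eq Lip_F by (intro exI[of _ "\<lambda>i. D (F i)"] conjI ballI refl) auto
    qed
  next
    fix b
    assume "b \<in> Lip_horizontal br H s e d \<Omega> \<and> induced_by br H s e d \<Omega> D b"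
    then obtain a where a: "\<forall>i\<in>?I. a i \<in> Lip d \<Omega>" "b = horizontal_field br H s e a"
      "\<forall>f\<in>C_infinity \<Omega>. D f = (\<lambda>x. \<Sum>i\<in>?I. a i x * ?X i f x)"
      unfolding induced_by_def by blast
    \<comment> \<open>Testing on \<open>F i\<close> isolates the coefficient \<open>a i\<close> on
      \<open>\<Omega>\<close>; off \<open>\<Omega>\<close> both functions are zero by convention.
      Hence the two fields agree as total functions.\<close>
    have "a i x = D (F i) x" if i: "i \<in> ?I" for i x
    proof (cases "x \<in> \<Omega>")
      case True
      have "D (F i) x = (\<Sum>j\<in>?I. a j x * ?X j (F i) x)"
        using a(3) F by metis
      also have "\<dots> = (\<Sum>j\<in>?I. if i = j then a j x else 0)"
        using XF[OF i _ True] by (intro sum.cong) auto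
      also have "\<dots> = a i x"
        using i by simp
      finally show ?thesis
        by simp
    next
      case False
      then show ?thesis
        using a(1) i Lip_F[of i] by (simp add: Lip_def)
    qed
    then show "b = horizontal_field br H s e (\<lambda>i. D (F i))"
      unfolding a(2) horizontal_field_def[abs_def] by (intro ext sum.cong) auto
  qed
qed

end
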